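(* Let $a,c,e$ be positive integers and let $b>-a$, $d>-c$ and $f>-e$ be integers with $a+b$, $c+d$, $e+f$ all even. Suppose that $a\geq c\geq e$, that $b\geq d$ if $a=c$, and that $d\geq f$ if $c=e$, and suppose that the ordered tuple $(a,b,c,d,e,f)$ is universal over $\mathbb N$. (i) If $a\mid b$, $c\mid d$ and $e\mid f$, but $b(a-b)$, $d(c-d)$, $f(e-f)$ are not all zero, then $(a,b,c,d,e,f)\in L_1\cup L_2$, where $L_1$ is the list of $56$ tuples and $L_2$ is the list of $10$ tuples given in the context. (ii) If $a\nmid b$ or $c\nmid d$ or $e\nmid f$, then $(a,b,c,d,e,f)\in L_3$, where $L_3$ is the list of $407$ tuples given in the context.
   Context: $\mathbb N=\{0,1,2,\ldots\}$. For positive integers $a,c,e$ and integers $b>-a$, $d>-c$, $f>-e$ with $a+b$, $c+d$, $e+f$ all even, the ordered tuple $(a,b,c,d,e,f)$ is called universal over $\mathbb N$ if every $n\in\mathbb N$ can be written as $\frac{x(ax+b)}2+\frac{y(cy+d)}2+\frac{z(ez+f)}2$ with $x,y,z\in\mathbb N$. $L_1$ consists of the following $56$ tuples: $(1,3,1,1,1,1)$, $(1,3,1,3,1,1)$, $(1,5,1,1,1,1)$, $(1,5,1,3,1,1)$, $(1,7,1,1,1,1)$, $(1,7,1,3,1,1)$, $(1,9,1,1,1,1)$, $(2,0,1,3,1,1)$, $(2,0,1,3,1,3)$, $(2,0,1,5,1,1)$, $(2,0,1,5,1,3)$, $(2,0,1,7,1,1)$, $(2,0,1,7,1,3)$, $(2,0,1,9,1,1)$,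 $(2,0,1,9,1,3)$, $(2,0,1,11,1,1)$, $(2,0,1,11,1,3)$, $(2,0,1,13,1,1)$, $(2,0,1,13,1,3)$, $(2,0,1,15,1,1)$, $(2,0,2,0,1,3)$, $(2,2,1,3,1,1)$, $(2,2,1,5,1,1)$, $(2,2,1,7,1,1)$, $(2,2,2,0,1,3)$, $(2,2,2,0,1,5)$, $(2,2,2,0,1,7)$, $(2,2,2,0,1,9)$, $(2,4,1,1,1,1)$, $(2,4,2,0,1,1)$, $(2,4,2,0,1,3)$, $(2,4,2,2,1,1)$, $(2,4,2,2,2,0)$, $(2,6,1,1,1,1)$, $(2,6,1,3,1,1)$, $(2,6,2,0,1,1)$, $(2,6,2,0,1,3)$, $(2,6,2,2,1,1)$, $(2,6,2,2,2,0)$, $(2,8,1,1,1,1)$, $(2,8,2,0,1,1)$, $(2,8,2,0,1,3)$, $(2,8,2,2,2,0)$, $(2,10,2,0,1,1)$, $(2,10,2,0,1,3)$, $(2,12,2,0,1,1)$, $(2,12,2,0,1,3)$, $(2,14,2,0,1,1)$, $(3,3,2,0,1,3)$, $(3,9,2,0,1,1)$, $(3,9,2,0,1,3)$, $(4,0,1,3,1,1)$, $(4,0,1,5,1,1)$, $(4,0,1,7,1,1)$, $(4,4,1,3,1,1)$, $(8,0,1,3,1,1)$. $L_2$ consists of the following $10$ tuples: $(4,0,2,0,1,3)$, $(4,0,2,0,1,5)$, $(4,0,2,6,1,1)$, $(4,0,2,6,2,0)$, $(4,4,2,0,1,3)$, $(4,8,2,0,1,1)$, $(4,8,2,0,1,3)$,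 $(4,12,2,0,1,1)$, $(6,0,2,0,1,3)$, $(6,6,2,0,1,3)$. $L_3$ consists of the following $407$ tuples. With first entry $3$: $(3,-1,1,1,1,1)$, $(3,-1,1,3,1,1)$, $(3,-1,1,5,1,1)$, $(3,-1,1,7,1,1)$, $(3,-1,1,9,1,1)$, $(3,-1,1,11,1,1)$, $(3,-1,1,13,1,1)$, $(3,-1,1,15,1,1)$, $(3,-1,1,17,1,1)$, $(3,-1,2,0,1,1)$, $(3,-1,2,0,1,3)$, $(3,-1,2,0,1,5)$, $(3,-1,2,0,2,0)$, $(3,-1,2,2,1,1)$, $(3,-1,2,2,1,3)$, $(3,-1,2,2,2,0)$, $(3,-1,2,4,1,1)$, $(3,-1,2,4,1,3)$, $(3,-1,2,4,2,2)$, $(3,-1,2,6,1,1)$, $(3,-1,2,8,1,1)$, $(3,-1,2,10,1,1)$, $(3,-1,2,12,1,1)$, $(3,-1,2,16,1,1)$, $(3,-1,3,-1,1,1)$, $(3,-1,3,-1,1,3)$, $(3,1,1,1,1,1)$, $(3,1,1,3,1,1)$, $(3,1,1,5,1,1)$, $(3,1,1,7,1,1)$, $(3,1,2,0,1,1)$, $(3,1,2,0,1,3)$, $(3,1,2,2,1,1)$, $(3,1,2,2,2,0)$, $(3,1,2,4,1,1)$, $(3,1,2,6,1,1)$, $(3,1,2,6,2,0)$, $(3,1,3,-1,1,1)$, $(3,1,3,-1,1,3)$, $(3,1,3,-1,2,2)$, $(3,1,3,-1,2,6)$, $(3,3,3,-1,1,1)$, $(3,3,3,-1,1,3)$, $(3,3,3,-1,2,0)$,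 $(3,3,3,-1,2,2)$, $(3,3,3,1,1,1)$, $(3,3,3,1,2,0)$, $(3,5,1,1,1,1)$, $(3,5,1,3,1,1)$, $(3,5,2,0,1,1)$, $(3,5,2,0,1,3)$, $(3,5,2,2,1,1)$, $(3,5,2,2,2,0)$, $(3,5,3,-1,1,1)$, $(3,5,3,1,1,1)$, $(3,7,1,1,1,1)$, $(3,7,2,0,1,1)$, $(3,7,2,2,2,0)$, $(3,7,3,-1,1,1)$, $(3,9,3,-1,1,1)$, $(3,11,2,0,1,1)$, $(3,11,2,0,1,3)$, $(3,11,3,-1,1,1)$, $(3,13,2,0,1,1)$, $(3,15,3,-1,1,1)$; with first entry $4$: $(4,-2,1,1,1,1)$, $(4,-2,1,3,1,1)$, $(4,-2,1,3,1,3)$, $(4,-2,1,5,1,1)$, $(4,-2,1,5,1,3)$, $(4,-2,1,7,1,1)$, $(4,-2,1,7,1,3)$, $(4,-2,1,9,1,1)$, $(4,-2,2,0,1,1)$, $(4,-2,2,0,1,3)$, $(4,-2,2,0,1,5)$, $(4,-2,2,2,1,1)$, $(4,-2,2,2,1,3)$, $(4,-2,2,2,1,5)$, $(4,-2,2,2,2,0)$, $(4,-2,2,4,1,1)$, $(4,-2,2,8,1,1)$, $(4,-2,3,-1,1,1)$, $(4,-2,3,-1,1,3)$, $(4,-2,3,-1,1,5)$, $(4,-2,3,-1,2,0)$, $(4,-2,3,1,1,1)$, $(4,-2,3,1,1,3)$, $(4,-2,3,1,2,0)$, $(4,-2,3,7,1,1)$, $(4,0,3,-1,1,1)$, $(4,0,3,-1,1,3)$,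 $(4,0,3,-1,1,5)$, $(4,0,3,-1,1,7)$, $(4,0,3,-1,2,0)$, $(4,0,3,-1,2,4)$, $(4,0,3,1,1,1)$, $(4,0,3,1,2,0)$, $(4,0,3,5,1,1)$, $(4,0,3,5,2,0)$, $(4,0,4,-2,1,1)$, $(4,0,4,-2,1,3)$, $(4,0,4,-2,1,5)$, $(4,0,4,-2,3,-1)$, $(4,2,2,0,1,1)$, $(4,2,2,0,1,3)$, $(4,2,3,-1,1,1)$, $(4,2,3,-1,1,3)$, $(4,4,3,-1,1,1)$, $(4,4,3,1,1,1)$, $(4,6,3,-1,1,1)$, $(4,8,3,-1,1,1)$, $(4,10,3,-1,1,1)$; with first entry $5$: $(5,-3,1,1,1,1)$, $(5,-3,1,3,1,1)$, $(5,-3,1,5,1,1)$, $(5,-3,1,7,1,1)$, $(5,-3,1,9,1,1)$, $(5,-3,2,0,1,1)$, $(5,-3,2,0,1,3)$, $(5,-3,2,2,1,1)$, $(5,-3,2,2,1,3)$, $(5,-3,2,2,2,0)$, $(5,-3,2,4,1,1)$, $(5,-3,2,4,1,3)$, $(5,-3,2,4,2,2)$, $(5,-3,2,8,1,1)$, $(5,-3,3,-1,1,1)$, $(5,-3,3,1,1,1)$, $(5,-3,3,1,1,3)$, $(5,-3,3,3,3,-1)$, $(5,-3,3,7,1,1)$, $(5,-1,2,0,1,1)$, $(5,-1,2,0,1,3)$, $(5,-1,2,0,1,5)$, $(5,-1,2,0,1,7)$, $(5,-1,2,0,1,9)$, $(5,-1,2,2,1,1)$, $(5,-1,2,6,1,1)$,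 $(5,-1,3,-1,1,1)$, $(5,-1,3,1,1,1)$, $(5,-1,4,0,1,1)$, $(5,1,2,0,1,1)$, $(5,1,2,0,1,3)$, $(5,1,2,2,1,1)$, $(5,1,3,-1,1,1)$, $(5,1,3,-1,1,3)$, $(5,1,3,1,1,1)$, $(5,3,1,1,1,1)$, $(5,3,1,3,1,1)$, $(5,3,2,0,1,1)$, $(5,3,2,2,1,1)$, $(5,3,2,2,2,0)$, $(5,3,3,-1,1,1)$, $(5,3,3,1,2,0)$, $(5,3,4,-2,1,1)$, $(5,3,4,-2,1,3)$, $(5,7,2,0,1,1)$, $(5,7,2,0,1,3)$, $(5,7,3,-1,1,1)$, $(5,9,3,-1,1,1)$, $(5,11,2,0,1,1)$, $(5,13,3,-1,1,1)$; with first entry $6$: $(6,-4,1,1,1,1)$, $(6,-4,1,3,1,1)$, $(6,-4,1,3,1,3)$, $(6,-4,1,5,1,1)$, $(6,-4,1,5,1,3)$, $(6,-4,1,7,1,1)$, $(6,-4,1,7,1,3)$, $(6,-4,1,9,1,1)$, $(6,-4,2,0,1,1)$, $(6,-4,2,0,1,3)$, $(6,-4,2,2,1,1)$, $(6,-4,2,2,1,3)$, $(6,-4,2,2,2,0)$, $(6,-4,2,6,1,1)$, $(6,-4,2,6,1,3)$, $(6,-4,3,-1,1,1)$, $(6,-4,3,1,1,1)$, $(6,-4,3,1,1,3)$, $(6,-4,3,1,1,5)$, $(6,-4,3,5,1,1)$, $(6,-4,3,7,1,1)$, $(6,-4,4,0,1,1)$, $(6,-4,4,0,1,3)$, $(6,-4,4,0,1,5)$,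 $(6,-4,4,0,1,7)$, $(6,-4,5,-3,1,1)$, $(6,-2,1,1,1,1)$, $(6,-2,1,3,1,1)$, $(6,-2,1,5,1,1)$, $(6,-2,1,7,1,1)$, $(6,-2,2,0,1,1)$, $(6,-2,2,0,1,3)$, $(6,-2,2,0,1,5)$, $(6,-2,2,0,1,7)$, $(6,-2,2,0,1,9)$, $(6,-2,2,2,2,0)$, $(6,-2,3,1,1,1)$, $(6,-2,4,-2,1,1)$, $(6,-2,4,-2,1,3)$, $(6,-2,4,-2,1,5)$, $(6,-2,4,0,1,1)$, $(6,-2,4,4,1,1)$, $(6,-2,5,-3,1,1)$, $(6,-2,5,-3,1,3)$, $(6,0,3,-1,1,1)$, $(6,0,3,-1,2,2)$, $(6,0,3,1,1,1)$, $(6,0,6,-4,1,1)$, $(6,0,6,-4,2,2)$, $(6,2,1,1,1,1)$, $(6,2,1,3,1,1)$, $(6,2,2,2,1,1)$, $(6,2,2,2,2,0)$, $(6,2,3,-1,1,1)$, $(6,2,3,1,1,1)$, $(6,2,4,0,1,1)$, $(6,2,6,-4,1,1)$, $(6,4,1,1,1,1)$, $(6,4,2,2,2,0)$, $(6,4,6,-4,1,1)$, $(6,6,3,-1,1,1)$, $(6,8,2,0,1,1)$, $(6,8,3,-1,1,1)$, $(6,10,2,0,1,1)$, $(6,12,3,-1,1,1)$; with first entry $7$: $(7,-5,2,0,1,1)$, $(7,-5,2,2,1,1)$, $(7,-5,2,4,1,1)$, $(7,-5,2,6,1,1)$, $(7,-5,2,8,1,1)$, $(7,-5,3,-1,1,1)$,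 $(7,-5,3,-1,1,3)$, $(7,-5,3,-1,2,2)$, $(7,-5,3,5,1,1)$, $(7,-5,4,0,1,1)$, $(7,-3,2,0,1,1)$, $(7,-3,2,2,1,1)$, $(7,-3,2,6,1,1)$, $(7,-3,3,-1,1,1)$, $(7,-3,3,-1,1,3)$, $(7,-3,3,-1,1,5)$, $(7,-3,3,1,1,1)$, $(7,-3,4,0,1,1)$, $(7,-1,2,0,1,1)$, $(7,-1,2,0,1,3)$, $(7,-1,2,2,1,1)$, $(7,-1,3,1,1,1)$, $(7,-1,6,-4,1,1)$, $(7,1,2,0,1,1)$, $(7,1,3,-1,1,1)$, $(7,3,1,1,1,1)$, $(7,3,2,2,2,0)$, $(7,5,2,0,1,1)$, $(7,5,2,0,1,3)$; with first entry $8$: $(8,-6,1,1,1,1)$, $(8,-6,1,3,1,1)$, $(8,-6,1,5,1,1)$, $(8,-6,1,7,1,1)$, $(8,-6,2,0,1,1)$, $(8,-6,2,2,1,1)$, $(8,-6,2,2,1,3)$, $(8,-6,2,2,2,0)$, $(8,-6,2,4,2,2)$, $(8,-6,3,1,1,1)$, $(8,-6,5,-3,1,1)$, $(8,-6,5,-3,1,3)$, $(8,-4,2,2,1,1)$, $(8,-4,2,6,1,1)$, $(8,-4,6,-4,1,1)$, $(8,-2,3,-1,1,1)$, $(8,-2,3,1,1,1)$, $(8,0,3,-1,1,1)$, $(8,0,3,1,1,1)$, $(8,0,6,-2,1,1)$, $(8,2,1,1,1,1)$, $(8,2,2,2,2,0)$; with first entry $9$: $(9,-7,2,0,1,1)$,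 $(9,-7,2,4,1,1)$, $(9,-7,2,8,1,1)$, $(9,-7,3,-1,1,1)$, $(9,-7,5,-1,1,1)$, $(9,-7,5,-1,1,3)$, $(9,-5,2,2,1,1)$, $(9,-5,2,6,1,1)$, $(9,-5,3,-1,1,1)$, $(9,-5,3,-1,1,3)$, $(9,-5,3,5,1,1)$, $(9,-5,4,0,1,1)$, $(9,-1,1,1,1,1)$, $(9,-1,1,3,1,1)$, $(9,-1,2,0,1,1)$, $(9,-1,2,2,1,1)$, $(9,-1,2,2,2,0)$, $(9,-1,4,0,1,1)$, $(9,5,3,-1,1,1)$, $(9,7,2,0,1,1)$, $(9,9,3,-1,1,1)$; with first entry $10$: $(10,-8,1,1,1,1)$, $(10,-8,1,3,1,1)$, $(10,-8,1,5,1,1)$, $(10,-8,1,7,1,1)$, $(10,-8,1,9,1,1)$, $(10,-8,2,0,1,1)$, $(10,-8,2,2,1,1)$, $(10,-8,2,2,1,3)$, $(10,-8,2,2,2,0)$, $(10,-8,2,4,1,1)$, $(10,-8,2,8,1,1)$, $(10,-8,3,1,1,1)$, $(10,-8,3,1,1,3)$, $(10,-8,3,7,1,1)$, $(10,-6,2,0,1,1)$, $(10,-6,2,0,1,3)$, $(10,-6,2,0,1,5)$, $(10,-6,2,2,1,1)$, $(10,-6,3,-1,1,1)$, $(10,-6,3,5,1,1)$, $(10,-6,5,-3,1,1)$, $(10,-4,2,0,1,1)$, $(10,-4,2,0,1,3)$, $(10,-4,3,-1,1,1)$, $(10,-2,3,-1,1,1)$, $(10,2,3,-1,1,1)$, $(10,4,3,-1,1,1)$,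 $(10,6,2,0,1,1)$, $(10,8,3,-1,1,1)$; with first entry $11$: $(11,-9,2,0,1,1)$, $(11,-9,3,-1,1,1)$, $(11,-9,3,1,1,1)$, $(11,-9,3,7,1,1)$, $(11,-7,1,1,1,1)$, $(11,-7,1,3,1,1)$, $(11,-7,1,5,1,1)$, $(11,-7,2,2,2,0)$, $(11,-7,3,-1,1,1)$, $(11,-5,2,0,1,1)$, $(11,-5,2,0,1,3)$, $(11,-3,3,-1,1,1)$, $(11,-3,3,1,1,1)$, $(11,5,2,0,1,1)$; with first entry at least $12$: $(12,-8,2,0,1,1)$, $(12,-8,2,0,1,3)$, $(12,-8,2,2,1,1)$, $(12,-4,1,1,1,1)$, $(12,-4,1,3,1,1)$, $(12,-4,2,2,1,1)$, $(12,-4,2,2,2,0)$, $(12,-4,4,0,1,1)$, $(13,-11,2,0,1,1)$, $(13,-11,2,2,1,1)$, $(13,-11,2,2,1,3)$, $(13,-9,2,0,1,1)$, $(13,-9,2,0,1,3)$, $(13,-7,2,0,1,1)$, $(13,-7,2,0,1,3)$, $(13,-5,2,0,1,1)$, $(14,-12,2,2,1,1)$, $(14,-10,2,0,1,1)$, $(14,-10,2,0,1,3)$, $(14,-10,2,2,1,1)$, $(14,-10,3,-1,1,1)$, $(14,-2,2,0,1,1)$, $(14,-2,3,-1,1,1)$, $(14,2,2,0,1,1)$, $(15,-13,1,1,1,1)$, $(15,-13,1,3,1,1)$, $(15,-13,1,5,1,1)$, $(15,-13,1,7,1,1)$, $(15,-13,1,9,1,1)$, $(15,-13,2,0,1,1)$,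 $(15,-13,2,2,1,1)$, $(15,-13,2,2,1,3)$, $(15,-13,2,2,2,0)$, $(15,-13,2,4,1,1)$, $(15,-13,2,4,2,2)$, $(15,-13,2,8,1,1)$, $(15,-13,3,1,1,1)$, $(15,-13,3,7,1,1)$, $(15,-13,4,0,1,1)$, $(15,-11,1,1,1,1)$, $(15,-11,2,0,1,1)$, $(15,-11,2,2,2,0)$, $(15,-7,1,1,1,1)$, $(15,-7,2,0,1,1)$, $(15,-7,2,2,1,1)$, $(15,-7,2,2,2,0)$, $(15,-3,3,-1,1,1)$, $(15,3,3,-1,1,1)$, $(16,-14,2,0,1,1)$, $(16,-10,2,0,1,1)$, $(16,-10,2,0,1,3)$, $(16,-8,3,-1,1,1)$, $(16,-4,2,0,1,1)$, $(17,-15,3,1,1,1)$, $(17,-15,3,1,1,3)$, $(18,-10,2,0,1,1)$, $(20,-16,2,2,1,1)$, $(20,-16,2,6,1,1)$, $(20,-12,3,-1,1,1)$, $(20,-4,2,0,1,1)$, $(21,-19,2,2,1,1)$, $(21,-9,2,0,1,1)$, $(21,-5,2,0,1,1)$, $(25,-23,2,0,1,1)$. *)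

theory Defs
  imports Main
begin

type_synonym coeff_tuple = "int \<times> int \<times> int \<times> int \<times> int \<times> int"

text \<open>The division by 2 is exact whenever \<open>a + b\<close>, \<open>c + d\<close> and \<open>e + f\<close> are
  even; see the lemma after the definition.\<close>

definition universal_over_nat :: "coeff_tuple \<Rightarrow> bool" where
  "universal_over_nat = (\<lambda>(a, b, c, d, e, f).
     \<forall>n :: nat. \<exists>x y z :: nat.
       int n = int x * (a * int x + b) div 2
             + int y * (c * int y + d) div 2
             + int z * (e * int z + f) div 2)"

lemma even_term:
  fixes a b x :: int
  assumes "even (a + b)"
  shows "even (x * (a * x + b))"
  using assms by auto

definition L1 :: "coeff_tuple list" where
  "L1 =
    [(1, 3, 1, 1, 1, 1), (1, 3, 1, 3, 1, 1), (1, 5, 1, 1, 1, 1), (1, 5, 1, 3, 1, 1),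
     (1, 7, 1, 1, 1, 1), (1, 7, 1, 3, 1, 1), (1, 9, 1, 1, 1, 1), (2, 0, 1, 3, 1, 1),
     (2, 0, 1, 3, 1, 3), (2, 0, 1, 5, 1, 1), (2, 0, 1, 5, 1, 3), (2, 0, 1, 7, 1, 1),
     (2, 0, 1, 7, 1, 3), (2, 0, 1, 9, 1, 1), (2, 0, 1, 9, 1, 3), (2, 0, 1, 11, 1, 1),
     (2, 0, 1, 11, 1, 3), (2, 0, 1, 13, 1, 1), (2, 0, 1, 13, 1, 3), (2, 0, 1, 15, 1, 1),
     (2, 0, 2, 0, 1, 3), (2, 2, 1, 3, 1, 1), (2, 2, 1, 5, 1, 1), (2, 2, 1, 7, 1, 1),
     (2, 2, 2, 0, 1, 3), (2, 2, 2, 0, 1, 5), (2, 2, 2, 0, 1, 7), (2, 2, 2, 0, 1, 9),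
     (2, 4, 1, 1, 1, 1), (2, 4, 2, 0, 1, 1), (2, 4, 2, 0, 1, 3), (2, 4, 2, 2, 1, 1),
     (2, 4, 2, 2, 2, 0), (2, 6, 1, 1, 1, 1), (2, 6, 1, 3, 1, 1), (2, 6, 2, 0, 1, 1),
     (2, 6, 2, 0, 1, 3), (2, 6, 2, 2, 1, 1), (2, 6, 2, 2, 2, 0), (2, 8, 1, 1, 1, 1),
     (2, 8, 2, 0, 1, 1), (2, 8, 2, 0, 1, 3), (2, 8, 2, 2, 2, 0), (2, 10, 2, 0, 1, 1),
     (2, 10, 2, 0, 1, 3), (2, 12, 2, 0, 1, 1), (2, 12, 2, 0, 1, 3), (2, 14, 2, 0, 1, 1),
     (3, 3, 2, 0, 1, 3), (3, 9, 2, 0, 1, 1), (3, 9, 2, 0, 1, 3), (4, 0, 1, 3, 1, 1),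
     (4, 0, 1, 5, 1, 1), (4, 0, 1, 7, 1, 1), (4, 4, 1, 3, 1, 1), (8, 0, 1, 3, 1, 1)]"

definition L2 :: "coeff_tuple list" where
  "L2 =
    [(4, 0, 2, 0, 1, 3), (4, 0, 2, 0, 1, 5), (4, 0, 2, 6, 1, 1), (4, 0, 2, 6, 2, 0),
     (4, 4, 2, 0, 1, 3), (4, 8, 2, 0, 1, 1), (4, 8, 2, 0, 1, 3), (4, 12, 2, 0, 1, 1),
     (6, 0, 2, 0, 1, 3), (6, 6, 2, 0, 1, 3)]"

definition L3 :: "coeff_tuple list" where
  "L3 =
    [(3, -1, 1, 1, 1, 1), (3, -1, 1, 3, 1, 1), (3, -1, 1, 5, 1, 1), (3, -1, 1, 7, 1, 1),
     (3, -1, 1, 9, 1, 1), (3, -1, 1, 11, 1, 1), (3, -1, 1, 13, 1, 1), (3, -1, 1, 15, 1, 1),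
     (3, -1, 1, 17, 1, 1), (3, -1, 2, 0, 1, 1), (3, -1, 2, 0, 1, 3), (3, -1, 2, 0, 1, 5),
     (3, -1, 2, 0, 2, 0), (3, -1, 2, 2, 1, 1), (3, -1, 2, 2, 1, 3), (3, -1, 2, 2, 2, 0),
     (3, -1, 2, 4, 1, 1), (3, -1, 2, 4, 1, 3), (3, -1, 2, 4, 2, 2), (3, -1, 2, 6, 1, 1),
     (3, -1, 2, 8, 1, 1), (3, -1, 2, 10, 1, 1), (3, -1, 2, 12, 1, 1), (3, -1, 2, 16, 1, 1),
     (3, -1, 3, -1, 1, 1), (3, -1, 3, -1, 1, 3), (3, 1, 1, 1, 1, 1), (3, 1, 1, 3, 1, 1),
     (3, 1, 1, 5, 1, 1), (3, 1, 1, 7, 1, 1), (3, 1, 2, 0, 1, 1), (3, 1, 2, 0, 1, 3),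
     (3, 1, 2, 2, 1, 1), (3, 1, 2, 2, 2, 0), (3, 1, 2, 4, 1, 1), (3, 1, 2, 6, 1, 1),
     (3, 1, 2, 6, 2, 0), (3, 1, 3, -1, 1, 1), (3, 1, 3, -1, 1, 3), (3, 1, 3, -1, 2, 2),
     (3, 1, 3, -1, 2, 6), (3, 3, 3, -1, 1, 1), (3, 3, 3, -1, 1, 3), (3, 3, 3, -1, 2, 0),
     (3, 3, 3, -1, 2, 2), (3, 3, 3, 1, 1, 1), (3, 3, 3, 1, 2, 0), (3, 5, 1, 1, 1, 1),
     (3, 5, 1, 3, 1, 1), (3, 5, 2, 0, 1, 1), (3, 5, 2, 0, 1, 3), (3, 5, 2, 2, 1, 1),
     (3, 5, 2, 2, 2, 0), (3, 5, 3, -1, 1, 1), (3, 5, 3, 1, 1, 1), (3, 7, 1, 1, 1, 1),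
     (3, 7, 2, 0, 1, 1), (3, 7, 2, 2, 2, 0), (3, 7, 3, -1, 1, 1), (3, 9, 3, -1, 1, 1),
     (3, 11, 2, 0, 1, 1), (3, 11, 2, 0, 1, 3), (3, 11, 3, -1, 1, 1), (3, 13, 2, 0, 1, 1),
     (3, 15, 3, -1, 1, 1), (4, -2, 1, 1, 1, 1), (4, -2, 1, 3, 1, 1), (4, -2, 1, 3, 1, 3),
     (4, -2, 1, 5, 1, 1), (4, -2, 1, 5, 1, 3), (4, -2, 1, 7, 1, 1), (4, -2, 1, 7, 1, 3),
     (4, -2, 1, 9, 1, 1), (4, -2, 2, 0, 1, 1), (4, -2, 2, 0, 1, 3), (4, -2, 2, 0, 1, 5),
     (4, -2, 2, 2, 1, 1), (4, -2, 2, 2, 1, 3), (4, -2, 2, 2, 1, 5), (4, -2, 2, 2, 2, 0),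
     (4, -2, 2, 4, 1, 1), (4, -2, 2, 8, 1, 1), (4, -2, 3, -1, 1, 1), (4, -2, 3, -1, 1, 3),
     (4, -2, 3, -1, 1, 5), (4, -2, 3, -1, 2, 0), (4, -2, 3, 1, 1, 1), (4, -2, 3, 1, 1, 3),
     (4, -2, 3, 1, 2, 0), (4, -2, 3, 7, 1, 1), (4, 0, 3, -1, 1, 1), (4, 0, 3, -1, 1, 3),
     (4, 0, 3, -1, 1, 5), (4, 0, 3, -1, 1, 7), (4, 0, 3, -1, 2, 0), (4, 0, 3, -1, 2, 4),
     (4, 0, 3, 1, 1, 1), (4, 0, 3, 1, 2, 0), (4, 0, 3, 5, 1, 1), (4, 0, 3, 5, 2, 0),
     (4, 0, 4, -2, 1, 1), (4, 0, 4, -2, 1, 3), (4, 0, 4, -2, 1, 5), (4, 0, 4, -2, 3, -1),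
     (4, 2, 2, 0, 1, 1), (4, 2, 2, 0, 1, 3), (4, 2, 3, -1, 1, 1), (4, 2, 3, -1, 1, 3),
     (4, 4, 3, -1, 1, 1), (4, 4, 3, 1, 1, 1), (4, 6, 3, -1, 1, 1), (4, 8, 3, -1, 1, 1),
     (4, 10, 3, -1, 1, 1), (5, -3, 1, 1, 1, 1), (5, -3, 1, 3, 1, 1), (5, -3, 1, 5, 1, 1),
     (5, -3, 1, 7, 1, 1), (5, -3, 1, 9, 1, 1), (5, -3, 2, 0, 1, 1), (5, -3, 2, 0, 1, 3),
     (5, -3, 2, 2, 1, 1), (5, -3, 2, 2, 1, 3), (5, -3, 2, 2, 2, 0), (5, -3, 2, 4, 1, 1),
     (5, -3, 2, 4, 1, 3), (5, -3, 2, 4, 2, 2), (5, -3, 2, 8, 1, 1), (5, -3, 3, -1, 1, 1),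
     (5, -3, 3, 1, 1, 1), (5, -3, 3, 1, 1, 3), (5, -3, 3, 3, 3, -1), (5, -3, 3, 7, 1, 1),
     (5, -1, 2, 0, 1, 1), (5, -1, 2, 0, 1, 3), (5, -1, 2, 0, 1, 5), (5, -1, 2, 0, 1, 7),
     (5, -1, 2, 0, 1, 9), (5, -1, 2, 2, 1, 1), (5, -1, 2, 6, 1, 1), (5, -1, 3, -1, 1, 1),
     (5, -1, 3, 1, 1, 1), (5, -1, 4, 0, 1, 1), (5, 1, 2, 0, 1, 1), (5, 1, 2, 0, 1, 3),
     (5, 1, 2, 2, 1, 1), (5, 1, 3, -1, 1, 1), (5, 1, 3, -1, 1, 3), (5, 1, 3, 1, 1, 1),
     (5, 3, 1, 1, 1, 1), (5, 3, 1, 3, 1, 1), (5, 3, 2, 0, 1, 1), (5, 3, 2, 2, 1, 1),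
     (5, 3, 2, 2, 2, 0), (5, 3, 3, -1, 1, 1), (5, 3, 3, 1, 2, 0), (5, 3, 4, -2, 1, 1),
     (5, 3, 4, -2, 1, 3), (5, 7, 2, 0, 1, 1), (5, 7, 2, 0, 1, 3), (5, 7, 3, -1, 1, 1),
     (5, 9, 3, -1, 1, 1), (5, 11, 2, 0, 1, 1), (5, 13, 3, -1, 1, 1), (6, -4, 1, 1, 1, 1),
     (6, -4, 1, 3, 1, 1), (6, -4, 1, 3, 1, 3), (6, -4, 1, 5, 1, 1), (6, -4, 1, 5, 1, 3),
     (6, -4, 1, 7, 1, 1), (6, -4, 1, 7, 1, 3), (6, -4, 1, 9, 1, 1), (6, -4, 2, 0, 1, 1),
     (6, -4, 2, 0, 1, 3), (6, -4, 2, 2, 1, 1), (6, -4, 2, 2, 1, 3), (6, -4, 2, 2, 2, 0),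
     (6, -4, 2, 6, 1, 1), (6, -4, 2, 6, 1, 3), (6, -4, 3, -1, 1, 1), (6, -4, 3, 1, 1, 1),
     (6, -4, 3, 1, 1, 3), (6, -4, 3, 1, 1, 5), (6, -4, 3, 5, 1, 1), (6, -4, 3, 7, 1, 1),
     (6, -4, 4, 0, 1, 1), (6, -4, 4, 0, 1, 3), (6, -4, 4, 0, 1, 5), (6, -4, 4, 0, 1, 7),
     (6, -4, 5, -3, 1, 1), (6, -2, 1, 1, 1, 1), (6, -2, 1, 3, 1, 1), (6, -2, 1, 5, 1, 1),
     (6, -2, 1, 7, 1, 1), (6, -2, 2, 0, 1, 1), (6, -2, 2, 0, 1, 3), (6, -2, 2, 0, 1, 5),
     (6, -2, 2, 0, 1, 7), (6, -2, 2, 0, 1, 9), (6, -2, 2, 2, 2, 0), (6, -2, 3, 1, 1, 1),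
     (6, -2, 4, -2, 1, 1), (6, -2, 4, -2, 1, 3), (6, -2, 4, -2, 1, 5), (6, -2, 4, 0, 1, 1),
     (6, -2, 4, 4, 1, 1), (6, -2, 5, -3, 1, 1), (6, -2, 5, -3, 1, 3), (6, 0, 3, -1, 1, 1),
     (6, 0, 3, -1, 2, 2), (6, 0, 3, 1, 1, 1), (6, 0, 6, -4, 1, 1), (6, 0, 6, -4, 2, 2),
     (6, 2, 1, 1, 1, 1), (6, 2, 1, 3, 1, 1), (6, 2, 2, 2, 1, 1), (6, 2, 2, 2, 2, 0),
     (6, 2, 3, -1, 1, 1), (6, 2, 3, 1, 1, 1), (6, 2, 4, 0, 1, 1), (6, 2, 6, -4, 1, 1),
     (6, 4, 1, 1, 1, 1), (6, 4, 2, 2, 2, 0), (6, 4, 6, -4, 1, 1), (6, 6, 3, -1, 1, 1),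
     (6, 8, 2, 0, 1, 1), (6, 8, 3, -1, 1, 1), (6, 10, 2, 0, 1, 1), (6, 12, 3, -1, 1, 1),
     (7, -5, 2, 0, 1, 1), (7, -5, 2, 2, 1, 1), (7, -5, 2, 4, 1, 1), (7, -5, 2, 6, 1, 1),
     (7, -5, 2, 8, 1, 1), (7, -5, 3, -1, 1, 1), (7, -5, 3, -1, 1, 3), (7, -5, 3, -1, 2, 2),
     (7, -5, 3, 5, 1, 1), (7, -5, 4, 0, 1, 1), (7, -3, 2, 0, 1, 1), (7, -3, 2, 2, 1, 1),
     (7, -3, 2, 6, 1, 1), (7, -3, 3, -1, 1, 1), (7, -3, 3, -1, 1, 3), (7, -3, 3, -1, 1, 5),
     (7, -3, 3, 1, 1, 1), (7, -3, 4, 0, 1, 1), (7, -1, 2, 0, 1, 1), (7, -1, 2, 0, 1, 3),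
     (7, -1, 2, 2, 1, 1), (7, -1, 3, 1, 1, 1), (7, -1, 6, -4, 1, 1), (7, 1, 2, 0, 1, 1),
     (7, 1, 3, -1, 1, 1), (7, 3, 1, 1, 1, 1), (7, 3, 2, 2, 2, 0), (7, 5, 2, 0, 1, 1),
     (7, 5, 2, 0, 1, 3), (8, -6, 1, 1, 1, 1), (8, -6, 1, 3, 1, 1), (8, -6, 1, 5, 1, 1),
     (8, -6, 1, 7, 1, 1), (8, -6, 2, 0, 1, 1), (8, -6, 2, 2, 1, 1), (8, -6, 2, 2, 1, 3),
     (8, -6, 2, 2, 2, 0), (8, -6, 2, 4, 2, 2), (8, -6, 3, 1, 1, 1), (8, -6, 5, -3, 1, 1),
     (8, -6, 5, -3, 1, 3), (8, -4, 2, 2, 1, 1), (8, -4, 2, 6, 1, 1), (8, -4, 6, -4, 1, 1),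
     (8, -2, 3, -1, 1, 1), (8, -2, 3, 1, 1, 1), (8, 0, 3, -1, 1, 1), (8, 0, 3, 1, 1, 1),
     (8, 0, 6, -2, 1, 1), (8, 2, 1, 1, 1, 1), (8, 2, 2, 2, 2, 0), (9, -7, 2, 0, 1, 1),
     (9, -7, 2, 4, 1, 1), (9, -7, 2, 8, 1, 1), (9, -7, 3, -1, 1, 1), (9, -7, 5, -1, 1, 1),
     (9, -7, 5, -1, 1, 3), (9, -5, 2, 2, 1, 1), (9, -5, 2, 6, 1, 1), (9, -5, 3, -1, 1, 1),
     (9, -5, 3, -1, 1, 3), (9, -5, 3, 5, 1, 1), (9, -5, 4, 0, 1, 1), (9, -1, 1, 1, 1, 1),
     (9, -1, 1, 3, 1, 1), (9, -1, 2, 0, 1, 1), (9, -1, 2, 2, 1, 1), (9, -1, 2, 2, 2, 0),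
     (9, -1, 4, 0, 1, 1), (9, 5, 3, -1, 1, 1), (9, 7, 2, 0, 1, 1), (9, 9, 3, -1, 1, 1),
     (10, -8, 1, 1, 1, 1), (10, -8, 1, 3, 1, 1), (10, -8, 1, 5, 1, 1), (10, -8, 1, 7, 1, 1),
     (10, -8, 1, 9, 1, 1), (10, -8, 2, 0, 1, 1), (10, -8, 2, 2, 1, 1), (10, -8, 2, 2, 1, 3),
     (10, -8, 2, 2, 2, 0), (10, -8, 2, 4, 1, 1), (10, -8, 2, 8, 1, 1), (10, -8, 3, 1, 1, 1),
     (10, -8, 3, 1, 1, 3), (10, -8, 3, 7, 1, 1), (10, -6, 2, 0, 1, 1), (10, -6, 2, 0, 1, 3),
     (10, -6, 2, 0, 1, 5), (10, -6, 2, 2, 1, 1), (10, -6, 3, -1, 1, 1), (10, -6, 3, 5, 1, 1),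
     (10, -6, 5, -3, 1, 1), (10, -4, 2, 0, 1, 1), (10, -4, 2, 0, 1, 3), (10, -4, 3, -1, 1, 1),
     (10, -2, 3, -1, 1, 1), (10, 2, 3, -1, 1, 1), (10, 4, 3, -1, 1, 1), (10, 6, 2, 0, 1, 1),
     (10, 8, 3, -1, 1, 1), (11, -9, 2, 0, 1, 1), (11, -9, 3, -1, 1, 1), (11, -9, 3, 1, 1, 1),
     (11, -9, 3, 7, 1, 1), (11, -7, 1, 1, 1, 1), (11, -7, 1, 3, 1, 1), (11, -7, 1, 5, 1, 1),
     (11, -7, 2, 2, 2, 0), (11, -7, 3, -1, 1, 1), (11, -5, 2, 0, 1, 1), (11, -5, 2, 0, 1, 3),
     (11, -3, 3, -1, 1, 1), (11, -3, 3, 1, 1, 1), (11, 5, 2, 0, 1, 1), (12, -8, 2, 0, 1, 1),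
     (12, -8, 2, 0, 1, 3), (12, -8, 2, 2, 1, 1), (12, -4, 1, 1, 1, 1), (12, -4, 1, 3, 1, 1),
     (12, -4, 2, 2, 1, 1), (12, -4, 2, 2, 2, 0), (12, -4, 4, 0, 1, 1), (13, -11, 2, 0, 1, 1),
     (13, -11, 2, 2, 1, 1), (13, -11, 2, 2, 1, 3), (13, -9, 2, 0, 1, 1), (13, -9, 2, 0, 1, 3),
     (13, -7, 2, 0, 1, 1), (13, -7, 2, 0, 1, 3), (13, -5, 2, 0, 1, 1), (14, -12, 2, 2, 1, 1),
     (14, -10, 2, 0, 1, 1), (14, -10, 2, 0, 1, 3), (14, -10, 2, 2, 1, 1), (14, -10, 3, -1, 1, 1),
     (14, -2, 2, 0, 1, 1), (14, -2, 3, -1, 1, 1), (14, 2, 2, 0, 1, 1), (15, -13, 1, 1, 1, 1),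
     (15, -13, 1, 3, 1, 1), (15, -13, 1, 5, 1, 1), (15, -13, 1, 7, 1, 1), (15, -13, 1, 9, 1, 1),
     (15, -13, 2, 0, 1, 1), (15, -13, 2, 2, 1, 1), (15, -13, 2, 2, 1, 3), (15, -13, 2, 2, 2, 0),
     (15, -13, 2, 4, 1, 1), (15, -13, 2, 4, 2, 2), (15, -13, 2, 8, 1, 1), (15, -13, 3, 1, 1, 1),
     (15, -13, 3, 7, 1, 1), (15, -13, 4, 0, 1, 1), (15, -11, 1, 1, 1, 1), (15, -11, 2, 0, 1, 1),
     (15, -11, 2, 2, 2, 0), (15, -7, 1, 1, 1, 1), (15, -7, 2, 0, 1, 1), (15, -7, 2, 2, 1, 1),
     (15, -7, 2, 2, 2, 0), (15, -3, 3, -1, 1, 1), (15, 3, 3, -1, 1, 1), (16, -14, 2, 0, 1, 1),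
     (16, -10, 2, 0, 1, 1), (16, -10, 2, 0, 1, 3), (16, -8, 3, -1, 1, 1), (16, -4, 2, 0, 1, 1),
     (17, -15, 3, 1, 1, 1), (17, -15, 3, 1, 1, 3), (18, -10, 2, 0, 1, 1), (20, -16, 2, 2, 1, 1),
     (20, -16, 2, 6, 1, 1), (20, -12, 3, -1, 1, 1), (20, -4, 2, 0, 1, 1), (21, -19, 2, 2, 1, 1),
     (21, -9, 2, 0, 1, 1), (21, -5, 2, 0, 1, 1), (25, -23, 2, 0, 1, 1)]"

lemma length_L1: "length L1 = 56"
  by (simp add: L1_def)

lemma length_L2: "length L2 = 10"
  by (simp add: L2_def)

lemma length_L3: "length L3 = 407"
  by (simp add: L3_def)

end

theory Submission
  imports Defs
begin

text \<open>
  Put \<open>v = (a + b) / 2\<close>. The terms \<open>x (a x + b) / 2\<close> increase strictly from \<open>0\<close> with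
  consecutive differences \<open>v, v + a, v + 2 a, \<dots>\<close>, so a progression is determined by its two
  terms \<open>v\<close> and \<open>2 v + a\<close>. Escalation: suppose only some of these six numbers are known and
  \<open>n\<close> is the least number not represented by the terms known so far. Universality then
  forces one of the unknown numbers to be at most \<open>n\<close>, which leaves finitely many cases for it.
  After six steps all parameters are fixed (\<open>1931\<close> tuples in the order required), and each tuple
  outside the lists that is not a sum of squares and triangular numbers misses some
  \<open>n \<le> 826\<close>.
\<close>

section \<open>Progressions, partial knowledge and masks\<close>

fun val :: "nat \<Rightarrow> nat \<Rightarrow> nat \<Rightarrow> nat" where
  "val v a 0 = 0"
| "val v a (Suc x) = v + val (v + a) a x"

fun represents :: "(nat \<times> nat) list \<Rightarrow> nat \<Rightarrow> bool" where
  "represents [] n \<longleftrightarrow> n = 0"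
| "represents ((v, a) # ps) n \<longleftrightarrow> (\<exists>x m. n = val v a x + m \<and> represents ps m)"

text \<open>
  What is known about one progression \<open>(v, a)\<close>: both parameters, or \<open>v\<close> and a lower bound for \<open>a\<close>,
  or only a lower bound for \<open>v\<close>. The lower bounds make the branches of the search disjoint.
\<close>

datatype part = Known nat nat | Start nat nat | Unknown nat

fun matches :: "part \<Rightarrow> nat \<times> nat \<Rightarrow> bool" where
  "matches (Known w c) (v, a) \<longleftrightarrow> v = w \<and> a = c \<and> v > 0 \<and> a > 0"
| "matches (Start w l) (v, a) \<longleftrightarrow> v = w \<and> l \<le> a \<and> v > 0 \<and> a > 0"
| "matches (Unknown l) (v, a) \<longleftrightarrow> l \<le> v \<and> v > 0 \<and> a > 0"

text \<open>
  A mask is the characteristic function of a set of natural numbers below \<open>N\<close>; \<open>val_mask N k v a\<close>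
  is that of the numbers \<open>k + val v a x\<close>.
\<close>

fun val_mask :: "nat \<Rightarrow> nat \<Rightarrow> nat \<Rightarrow> nat \<Rightarrow> bool list" where
  "val_mask 0 k v a = []"
| "val_mask (Suc N) 0 v a = True # val_mask N (v - 1) (v + a) a"
| "val_mask (Suc N) (Suc k) v a = False # val_mask N k v a"

fun or_mask :: "bool list \<Rightarrow> bool list \<Rightarrow> bool list" where
  "or_mask (True # A) (b # B) = True # or_mask A B"
| "or_mask (False # A) (b # B) = b # or_mask A B"
| "or_mask A B = []"

fun sum_mask :: "bool list \<Rightarrow> bool list \<Rightarrow> bool list" where
  "sum_mask [] B = []"
| "sum_mask (True # A) B = or_mask B (False # sum_mask A B)"
| "sum_mask (False # A) B = False # sum_mask A B"

text \<open>The difference \<open>N\<close> moves the terms that are not yet known beyond the end of the mask.\<close>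

fun part_mask :: "nat \<Rightarrow> part \<Rightarrow> bool list" where
  "part_mask N (Known v a) = val_mask N 0 v a"
| "part_mask N (Start v l) = val_mask N 0 v N"
| "part_mask N (Unknown l) = val_mask N 0 N N"

fun parts_mask :: "nat \<Rightarrow> part list \<Rightarrow> bool list" where
  "parts_mask N [] = val_mask N 0 N N"
| "parts_mask N (p # ps) = sum_mask (part_mask N p) (parts_mask N ps)"

fun first_false :: "bool list \<Rightarrow> nat" where
  "first_false (True # A) = Suc (first_false A)"
| "first_false A = 0"

fun has_false :: "bool list \<Rightarrow> bool" where
  "has_false [] = False"
| "has_false (False # A) = True"
| "has_false (True # A) = has_false A"

section \<open>Branching at a gap and the search\<close>

fun refine :: "nat \<Rightarrow> part \<Rightarrow> part list" where
  "refine n (Known v a) = []"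
| "refine n (Start v l) = map (Known v) [l..<Suc n - 2 * v]"
| "refine n (Unknown l) = map (\<lambda>v. Start v 1) [l..<Suc n]"

fun raise :: "nat \<Rightarrow> part \<Rightarrow> part" where
  "raise n (Known v a) = Known v a"
| "raise n (Start v l) = Start v (max l (Suc n - 2 * v))"
| "raise n (Unknown l) = Unknown (max l (Suc n))"

text \<open>Each branch settles the first progression whose next unknown number is at most
  \<open>n\<close>; for the earlier ones \<open>raise\<close> records that theirs exceeds
  \<open>n\<close>.\<close>

fun branches :: "nat \<Rightarrow> part list \<Rightarrow> part list list" where
  "branches n [] = []"
| "branches n (p # ps) = map (\<lambda>q. q # ps) (refine n p) @ map ((#) (raise n p)) (branches n ps)"

text \<open>As \<open>b = 2 * v - a\<close>, comparing \<open>v\<close> for equal \<open>a\<close>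
  amounts to comparing \<open>b\<close>.\<close>

fun dominates :: "nat \<times> nat \<Rightarrow> nat \<times> nat \<Rightarrow> bool" where
  "dominates (v, a) (w, c) \<longleftrightarrow> c < a \<or> c = a \<and> w \<le> v"

fun out_of_order :: "part \<Rightarrow> part \<Rightarrow> bool" where
  "out_of_order (Known v a) (Known w c) \<longleftrightarrow> \<not> dominates (v, a) (w, c)"
| "out_of_order _ _ \<longleftrightarrow> False"

fun unordered :: "part list \<Rightarrow> bool" where
  "unordered (p # q # qs) \<longleftrightarrow> out_of_order p q \<or> unordered (q # qs)"
| "unordered _ \<longleftrightarrow> False"

text \<open>With \<open>b = 2 * v - a\<close> this says \<open>b = a\<close> or
  \<open>b = 0\<close>: multiples of triangular numbers or of squares.\<close>

fun square_or_triangular :: "nat \<times> nat \<Rightarrow> bool" where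
  "square_or_triangular (v, a) \<longleftrightarrow> a = v \<or> a = 2 * v"

text \<open>
  \<open>T\<close> is the list of exceptional triples, thinned out along the search to those compatible with
  \<open>qs\<close>. The bound \<open>42\<close> suffices for the first gap of every incomplete state; the cheap short
  masks already exclude most complete ones.
\<close>

fun check :: "nat \<Rightarrow> (nat \<times> nat) list list \<Rightarrow> part list \<Rightarrow> bool" where
  "check 0 T [Known u a, Known v c, Known w e] \<longleftrightarrow>
     unordered [Known u a, Known v c, Known w e]
     \<or> list_all square_or_triangular [(u, a), (v, c), (w, e)]
     \<or> list_ex ((=) [(u, a), (v, c), (w, e)]) T
     \<or> (let qs = [Known u a, Known v c, Known w e] in
         has_false (parts_mask 40 qs) \<or> has_false (parts_mask 100 qs) \<or>
         has_false (parts_mask 200 qs) \<or> has_false (parts_mask 420 qs) \<or>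
         has_false (parts_mask 827 qs))"
| "check 0 T qs \<longleftrightarrow> False"
| "check (Suc k) T qs \<longleftrightarrow> unordered qs \<or>
     (let n = first_false (parts_mask 42 qs) in
       n < 42 \<and> list_all (check k (filter (list_all2 matches qs) T)) (branches n qs))"

fun parameters :: "coeff_tuple \<Rightarrow> (nat \<times> nat) list" where
  "parameters (a, b, c, d, e, f) =
     [(nat ((a + b) div 2), nat a), (nat ((c + d) div 2), nat c), (nat ((e + f) div 2), nat e)]"

section \<open>Correctness of the masks\<close>

lemma length_val_mask [simp]: "length (val_mask N k v a) = N"
  by (induction N k v a rule: val_mask.induct) auto

lemma val_mask_nth:
  assumes "v > 0" "k + val v a x < N"
  shows "val_mask N k v a ! (k + val v a x)"
  using assms
proof (induction N k v a arbitrary: x rule: val_mask.induct)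
  case (2 N v a)
  show ?case
  proof (cases x)
    case (Suc y)
    obtain w where "v = Suc w"
      using 2 gr0_implies_Suc by auto
    then show ?thesis
      using 2(1)[of y] 2(3) Suc by simp
  qed simp
qed auto

lemma length_or_mask [simp]: "length (or_mask A B) = min (length A) (length B)"
  by (induction A B rule: or_mask.induct) auto

lemma or_mask_nth:
  assumes "i < length A" "i < length B"
  shows "or_mask A B ! i \<longleftrightarrow> A ! i \<or> B ! i"
  using assms by (induction A B arbitrary: i rule: or_mask.induct) (auto simp: nth_Cons')

lemma length_sum_mask [simp]:
  "length A \<le> length B \<Longrightarrow> length (sum_mask A B) = length A"
  by (induction A B rule: sum_mask.induct) auto

lemma sum_mask_nth:
  assumes "length A \<le> length B" "j + k < length A" "A ! j" "B ! k"
  shows "sum_mask A B ! (j + k)"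
  using assms
proof (induction A B arbitrary: j rule: sum_mask.induct)
  case (2 A B)
  then show ?case
    by (cases j) (auto simp: or_mask_nth)
next
  case (3 A B)
  then show ?case
    by (cases j) auto
qed simp

lemma length_part_mask [simp]: "length (part_mask N q) = N"
  by (cases q) auto

lemma length_parts_mask [simp]: "length (parts_mask N qs) = N"
  by (induction qs) auto

fun next_le :: "nat \<Rightarrow> part \<Rightarrow> nat \<times> nat \<Rightarrow> bool" where
  "next_le n (Known w c) (v, a) \<longleftrightarrow> False"
| "next_le n (Start w l) (v, a) \<longleftrightarrow> 2 * v + a \<le> n"
| "next_le n (Unknown l) (v, a) \<longleftrightarrow> v \<le> n"

text \<open>Terms increase, so if the next unknown number exceeds \<open>n\<close>, a term up to
  \<open>n\<close> has \<open>x \<le> 1\<close> (\<open>Start\<close>) or \<open>x = 0\<close>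
  (\<open>Unknown\<close>), and these the mask records.\<close>

lemma part_mask_nth:
  assumes "matches q (v, a)" "\<not> next_le n q (v, a)" "val v a x \<le> n" "n < N"
  shows "part_mask N q ! val v a x"
proof (cases q)
  case (Known w c)
  then show ?thesis
    using assms val_mask_nth[of v 0 a x N] by auto
next
  case (Start w l)
  have "x = 0 \<or> x = 1"
  proof (rule ccontr)
    assume "\<not> ?thesis"
    then obtain y where "x = Suc (Suc y)"
      by (metis One_nat_def not0_implies_Suc)
    then show False
      using assms Start by simp
  qed
  \<comment> \<open>The terms at \<open>0\<close> and \<open>1\<close> do not involve the
    difference.\<close>
  then have "val v a x = val v N x"
    by auto
  then show ?thesis
    using assms Start val_mask_nth[of v 0 N x N] by auto
next
  case (Unknown l)
  have "x = 0"
    using assms Unknown by (cases x) auto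
  then show ?thesis
    using assms Unknown val_mask_nth[of N 0 N 0 N] by auto
qed

text \<open>Read contrapositively, a gap at a represented \<open>n\<close> forces some unknown
  number to be at most \<open>n\<close>. Allowing \<open>m \<le> n\<close> covers the remainders in
  the induction.\<close>

lemma parts_mask_nth:
  assumes "list_all2 matches qs ps" "list_all2 (\<lambda>q p. \<not> next_le n q p) qs ps"
    and "represents ps m" "m \<le> n" "n < N"
  shows "parts_mask N qs ! m"
  using assms
proof (induction qs arbitrary: ps m)
  case Nil
  then show ?case
    using val_mask_nth[of N 0 N 0 N] by simp
next
  case (Cons q qs)
  from Cons.prems obtain v a ps' where ps: "ps = (v, a) # ps'"
    by (auto simp: list_all2_Cons1)
  from Cons.prems ps obtain x k where k: "m = val v a x + k" "represents ps' k"
    by auto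
  have "parts_mask N qs ! k"
    using Cons.prems ps k by (intro Cons.IH) auto
  moreover have "part_mask N q ! val v a x"
    using Cons.prems ps k by (intro part_mask_nth[of _ _ _ n]) auto
  ultimately show ?case
    using Cons.prems k by (auto intro!: sum_mask_nth)
qed

section \<open>Exhaustiveness of the search\<close>

lemma refine_matches:
  assumes "matches q p" "next_le n q p"
  shows "\<exists>q' \<in> set (refine n q). matches q' p"
  using assms by (cases p; cases q) auto

lemma raise_matches:
  assumes "matches q p" "\<not> next_le n q p"
  shows "matches (raise n q) p"
  using assms by (cases p; cases q) auto

lemma branches_matches:
  assumes "list_all2 matches qs ps" "\<not> list_all2 (\<lambda>q p. \<not> next_le n q p) qs ps"
  shows "\<exists>qs' \<in> set (branches n qs). list_all2 matches qs' ps"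
  using assms
proof (induction rule: list_all2_induct)
  case (Cons q qs p ps)
  show ?case
  proof (cases "next_le n q p")
    case True
    then show ?thesis
      using refine_matches[of q p n] Cons by auto
  next
    case False
    then show ?thesis
      using raise_matches[of q p n] Cons by auto
  qed
qed simp

text \<open>Without a gap \<open>first_false\<close> returns the length, so the bound ensures a
  genuine gap.\<close>

lemma first_false_nth: "first_false A < length A \<Longrightarrow> \<not> A ! first_false A"
  by (induction A rule: first_false.induct) auto

lemma has_false_nth: "has_false A \<Longrightarrow> \<exists>n < length A. \<not> A ! n"
  by (induction A rule: has_false.induct) auto

lemma not_out_of_order:
  "matches q (v, a) \<Longrightarrow> matches r (w, c) \<Longrightarrow> dominates (v, a) (w, c) \<Longrightarrow> \<not> out_of_order q r"
  by (cases q; cases r) auto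

text \<open>Justifies discarding a state once two fully known neighbours violate the order.\<close>

lemma not_unordered:
  assumes "list_all2 matches qs ps" "sorted_wrt dominates ps"
  shows "\<not> unordered qs"
  using assms
proof (induction qs arbitrary: ps rule: unordered.induct)
  case (1 q r qs)
  then obtain v a w c ps' where ps: "ps = (v, a) # (w, c) # ps'"
    by (auto simp: list_all2_Cons1)
  have "\<not> unordered (r # qs)"
    using 1 ps by (intro 1(1)[of "(w, c) # ps'"]) auto
  moreover have "\<not> out_of_order q r"
    using 1 ps by (intro not_out_of_order[of q v a r w c]) auto
  ultimately show ?case
    by simp
qed auto

lemma check_sound:
  assumes "check k T qs" "list_all2 matches qs ps" "sorted_wrt dominates ps" "\<forall>n. represents ps n"
  shows "ps \<in> set T \<or> list_all square_or_triangular ps"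
  using assms
proof (induction k T qs rule: check.induct)
  case (1 T u a v c w e)
  let ?qs = "[Known u a, Known v c, Known w e]"
  \<comment> \<open>No number is unknown here, so universality makes every mask entry true.\<close>
  have "list_all2 (\<lambda>q p. \<not> next_le n q p) ?qs ps" for n
    using 1(2) by (auto simp: list_all2_Cons1)
  then have "parts_mask N ?qs ! n" if "n < N" for n N
    using 1(2,4) that by (intro parts_mask_nth[of _ ps n n]) auto
  then have "\<not> has_false (parts_mask N ?qs)" for N
    using has_false_nth[of "parts_mask N ?qs"] by (metis length_parts_mask)
  moreover have "ps = [(u, a), (v, c), (w, e)]"
    using 1(2) by (auto simp: list_all2_Cons1)
  ultimately show ?case
    using 1(1) not_unordered[OF 1(2,3)] by (auto simp: Let_def list_ex_iff)
next
  case (3 k T qs)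
  define n where "n = first_false (parts_mask 42 qs)"
  have n: "n < 42" "list_all (check k (filter (list_all2 matches qs) T)) (branches n qs)"
    using 3(2) not_unordered[OF 3(3,4)] by (auto simp: n_def Let_def)
  then have "\<not> parts_mask 42 qs ! n"
    using first_false_nth[of "parts_mask 42 qs"] by (simp add: n_def)
  \<comment> \<open>The gap can only be filled with the help of a number still unknown.\<close>
  then have "\<not> list_all2 (\<lambda>q p. \<not> next_le n q p) qs ps"
    using parts_mask_nth[of qs ps n n 42] 3(3,5) n by auto
  then obtain qs' where "qs' \<in> set (branches n qs)" "list_all2 matches qs' ps"
    using branches_matches 3(3) by blast
  then show ?case
    using 3(1)[OF n_def, of qs'] 3(4,5) n by (auto simp: list_all_iff)
qed auto

section \<open>Return to integer tuples\<close>

lemma two_val: "2 * int (val v a x) = int x * (int a * int x + (2 * int v - int a))"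
  by (induction v a x rule: val.induct) (simp_all add: algebra_simps)

text \<open>Each branching fixes one of the six numbers, hence depth \<open>6\<close>.\<close>

lemma check_parameters:
  "check 6 (map parameters (L1 @ L2 @ L3)) [Unknown 1, Unknown 1, Unknown 1]"
  by code_simp

text \<open>The search yields only the joined list; divisibility tells part (i) from part
  (ii).\<close>

lemma lists_dvd:
  "list_all (\<lambda>(a, b, c, d, e, f). a dvd b \<and> c dvd d \<and> e dvd f) (L1 @ L2)"
  "list_all (\<lambda>(a, b, c, d, e, f). \<not> (a dvd b \<and> c dvd d \<and> e dvd f)) L3"
  by code_simp+

text \<open>\<open>nat\<close> and \<open>div\<close> lose information in general; positivity and
  parity make \<open>parameters\<close> injective on the lists.\<close>

lemma lists_admissible:
  "list_all (\<lambda>(a, b, c, d, e, f). a > 0 \<and> c > 0 \<and> e > 0 \<and> a + b > 0 \<and> c + d > 0 \<and> e + f > 0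
     \<and> even (a + b) \<and> even (c + d) \<and> even (e + f)) (L1 @ L2 @ L3)"
  by code_simp

lemma nat_parameters_eqD:
  fixes a b :: int
  assumes "nat ((a + b) div 2) = v" "nat a = k" "a > 0" "a + b > 0" "even (a + b)"
  shows "a = int k" "b = 2 * int v - int k"
proof -
  from assms(5) obtain l where "a + b = 2 * l"
    by (elim evenE)
  then show "a = int k" "b = 2 * int v - int k"
    using assms(1-4) by auto
qed

lemma parameters_eqD:
  assumes "(a, b, c, d, e, f) \<in> set (L1 @ L2 @ L3)"
    and "parameters (a, b, c, d, e, f) = [(u, k), (v, l), (w, m)]"
  shows "(a, b, c, d, e, f) =
    (int k, 2 * int u - int k, int l, 2 * int v - int l, int m, 2 * int w - int m)"
proof -
  have adm: "a > 0 \<and> c > 0 \<and> e > 0 \<and> a + b > 0 \<and> c + d > 0 \<and> e + f > 0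
      \<and> even (a + b) \<and> even (c + d) \<and> even (e + f)"
    using bspec[OF lists_admissible[unfolded list_all_iff] assms(1)] by (simp only: prod.case)
  have eqs: "nat ((a + b) div 2) = u" "nat a = k" "nat ((c + d) div 2) = v" "nat c = l"
      "nat ((e + f) div 2) = w" "nat e = m"
    using assms(2) by simp_all
  show ?thesis
    using adm nat_parameters_eqD[OF eqs(1,2)] nat_parameters_eqD[OF eqs(3,4)]
      nat_parameters_eqD[OF eqs(5,6)] by blast
qed

lemma obtain_val:
  fixes a b :: int
  assumes "a > 0" "b > - a" "even (a + b)"
  obtains v c :: nat where "v > 0" "c > 0" "a = int c" "b = 2 * int v - int c"
    "\<And>x. int x * (a * int x + b) div 2 = int (val v c x)"
proof -
  from assms(3) obtain k where k: "a + b = 2 * k"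
    by (elim evenE)
  define v c where "v = nat k" and "c = nat a"
  have "v > 0" "c > 0" and a: "a = int c" and b: "b = 2 * int v - int c"
    using assms k by (auto simp: v_def c_def)
  moreover have "int x * (a * int x + b) div 2 = int (val v c x)" for x
    unfolding a b by (simp add: two_val[symmetric])
  ultimately show ?thesis
    using that by blast
qed

theorem theorem1p4:
  fixes a b c d e f :: int
  assumes "a > 0" and "c > 0" and "e > 0"
    and "b > - a" and "d > - c" and "f > - e"
    and "even (a + b)" and "even (c + d)" and "even (e + f)"
    and "a \<ge> c" and "c \<ge> e"
    and "a = c \<Longrightarrow> b \<ge> d" and "c = e \<Longrightarrow> d \<ge> f"
    and "universal_over_nat (a, b, c, d, e, f)"
  shows "(a dvd b \<and> c dvd d \<and> e dvd f \<and>
           \<not> (b * (a - b) = 0 \<and> d * (c - d) = 0 \<and> f * (e - f) = 0)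
            \<longrightarrow> (a, b, c, d, e, f) \<in> set L1 \<union> set L2)
       \<and> (\<not> a dvd b \<or> \<not> c dvd d \<or> \<not> e dvd f
            \<longrightarrow> (a, b, c, d, e, f) \<in> set L3)"
proof -
  obtain u a' where a: "u > 0" "a' > 0" "a = int a'" "b = 2 * int u - int a'"
    and val_a: "\<And>x. int x * (a * int x + b) div 2 = int (val u a' x)"
    using obtain_val[of a b] assms by blast
  obtain v c' where c: "v > 0" "c' > 0" "c = int c'" "d = 2 * int v - int c'"
    and val_c: "\<And>x. int x * (c * int x + d) div 2 = int (val v c' x)"
    using obtain_val[of c d] assms by blast
  obtain w e' where e: "w > 0" "e' > 0" "e = int e'" "f = 2 * int w - int e'"
    and val_e: "\<And>x. int x * (e * int x + f) div 2 = int (val w e' x)"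
    using obtain_val[of e f] assms by blast
  let ?ps = "[(u, a'), (v, c'), (w, e')]"
  have "\<forall>n. \<exists>x y z. n = val u a' x + val v c' y + val w e' z"
    using assms(14) unfolding universal_over_nat_def
    by (simp add: val_a val_c val_e flip: of_nat_add)
  then have "\<forall>n. represents ?ps n"
    by (simp add: add.assoc) blast
  moreover have "sorted_wrt dominates ?ps"
    using assms(10-13) a c e by force
  moreover have "list_all2 matches [Unknown 1, Unknown 1, Unknown 1] ?ps"
    using a c e by simp
  ultimately consider "?ps \<in> set (map parameters (L1 @ L2 @ L3))"
    | "list_all square_or_triangular ?ps"
    using check_sound[OF check_parameters] by blast
  then show ?thesis
  proof cases
    case 1
    then have "?ps \<in> parameters ` set (L1 @ L2 @ L3)"
      by (simp only: set_map)
    then obtain t where t: "?ps = parameters t" "t \<in> set (L1 @ L2 @ L3)"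
      by (rule imageE)
    obtain a2 b2 c2 d2 e2 f2 where t_eq: "t = (a2, b2, c2, d2, e2, f2)"
      by (rule prod_cases6)
    have "t = (a, b, c, d, e, f)"
      unfolding t_eq a(3,4) c(3,4) e(3,4) using t(2) t(1)[symmetric] unfolding t_eq
      by (rule parameters_eqD)
    then have "(a, b, c, d, e, f) \<in> set (L1 @ L2 @ L3)"
      using t(2) by (simp only:)
    then consider "(a, b, c, d, e, f) \<in> set (L1 @ L2)" | "(a, b, c, d, e, f) \<in> set L3"
      by auto
    then show ?thesis
    proof cases
      case 1
      then show ?thesis
        using bspec[OF lists_dvd(1)[unfolded list_all_iff] 1] by auto
    next
      case 2
      then show ?thesis
        using bspec[OF lists_dvd(2)[unfolded list_all_iff] 2] by auto
    qed
  next
    case 2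
    \<comment> \<open>Each linear coefficient is \<open>0\<close> or equals its leading one, so the
      premises of both claims fail.\<close>
    then have "b * (a - b) = 0 \<and> a dvd b" "d * (c - d) = 0 \<and> c dvd d" "f * (e - f) = 0 \<and> e dvd f"
      using a c e by auto
    then show ?thesis
      by blast
  qed
qed

end
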